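(* Let $T$ be a starlike tree. Then, counted with multiplicity, exactly one eigenvalue of the graph Laplacian $L(T)$ is greater than or equal to $4$. Moreover, this eigenvalue is equal to $4$ if and only if $T$ is (isomorphic to) the claw $K_{1,3}=S(1,1,1)$.
   Context: For a finite simple unweighted undirected graph $G$ with vertices $v_1,\dots,v_n$, the graph Laplacian is $L(G)=D(G)-A(G)$, where $D(G)=\operatorname{diag}(d(v_1),\dots,d(v_n))$ is the diagonal matrix of vertex degrees and $A(G)=(a_{ij})$ is the adjacency matrix ($a_{ij}=1$ if $v_i,v_j$ are adjacent, and $0$ otherwise). A starlike tree is a (finite) tree that has exactly one vertex of degree higher than $2$. The notation $S(n_1,\dots,n_k)$, with $k\ge 3$ and $n_1\ge n_2\ge\cdots\ge n_k\ge 1$, denotes the starlike tree with $k$ paths (branches) emanating from the central vertex $v_1$, where the $i$th branch has $n_i$ vertices excluding $v_1$; it has $n=1+\sum_{i=1}^k n_i$ vertices. $K_{1,3}$ is the star with one central vertex and three leaves. *)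

theory Defs
  imports
    "Graph_Theory.Graph_Theory"
    "Jordan_Normal_Form.Char_Poly"
begin

text \<open>
  Finite simple undirected graphs are \<open>pair_graph\<close>s: finite, loop-free digraphs with a symmetric
  set of vertex pairs as arcs, each edge being represented by two opposite arcs. Consequently the
  degree of a vertex is its out-degree.

  The predicate \<open>tree\<close> of \<open>Graph_Theory.Digraph_Component\<close> is not usable here: an edge traversed
  back and forth is a \<open>cycle\<close> of length two of the symmetric digraph, so a symmetric digraph with
  an edge is never a \<open>forest\<close>. Cycles of the undirected graph are those of length at least three.
\<close>

definition vertex_degree :: "'a pair_pre_digraph \<Rightarrow> 'a \<Rightarrow> nat" where
  "vertex_degree G v = out_degree (with_proj G) v"

definition undirected_tree :: "'a pair_pre_digraph \<Rightarrow> bool" where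
  "undirected_tree G \<longleftrightarrow>
     pair_graph G \<and> Digraph_Component.connected (with_proj G) \<and>
     \<not> (\<exists>p. pre_digraph.cycle (with_proj G) p \<and> length p \<ge> 3)"

definition starlike_tree :: "'a pair_pre_digraph \<Rightarrow> bool" where
  "starlike_tree G \<longleftrightarrow> undirected_tree G \<and> (\<exists>!v. v \<in> pverts G \<and> vertex_degree G v > 2)"

definition claw :: "nat pair_pre_digraph" where
  "claw = \<lparr> pverts = {0, 1, 2, 3}, parcs = {0} \<times> {1, 2, 3} \<union> {1, 2, 3} \<times> {0} \<rparr>"

text \<open>In the following, the list \<open>vs\<close> is the numbering of the vertices.\<close>

definition degree_matrix :: "'a pair_pre_digraph \<Rightarrow> 'a list \<Rightarrow> real mat" where
  "degree_matrix G vs =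
     mat (length vs) (length vs) (\<lambda>(i, j). if i = j then real (vertex_degree G (vs ! i)) else 0)"

definition adjacency_matrix :: "'a pair_pre_digraph \<Rightarrow> 'a list \<Rightarrow> real mat" where
  "adjacency_matrix G vs =
     mat (length vs) (length vs) (\<lambda>(i, j). if (vs ! i, vs ! j) \<in> parcs G then 1 else 0)"

definition laplacian :: "'a pair_pre_digraph \<Rightarrow> 'a list \<Rightarrow> real mat" where
  "laplacian G vs = degree_matrix G vs - adjacency_matrix G vs"

text \<open>
  Eigenvalues with algebraic multiplicity. Only real eigenvalues are counted, which for the
  symmetric matrices \<open>laplacian G vs\<close> are all of them.
\<close>

definition eigenvalue_mset :: "real mat \<Rightarrow> real multiset" where
  "eigenvalue_mset A = proots (char_poly A)"

lemma in_eigenvalue_mset_iff: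
  assumes "A \<in> carrier_mat n n"
  shows "x \<in># eigenvalue_mset A \<longleftrightarrow> eigenvalue A x"
proof -
  have "char_poly A \<noteq> 0"
    using degree_monic_char_poly[OF assms] by auto
  then show ?thesis
    by (simp add: eigenvalue_mset_def eigenvalue_root_char_poly[OF assms])
qed

end

theory Submission
  imports Defs
begin

text \<open>
  Let \<open>c\<close> be the vertex of degree \<open>k \<ge> 3\<close> and \<open>L\<close> the Laplacian. The number of eigenvalues that are
  at least \<open>4\<close> is bounded from both sides by means of the quadratic form \<open>x \<bullet> L x\<close>.

  At most one: \<open>L\<close> and the signless Laplacian \<open>Q = D + A\<close> satisfy \<open>L + Q = 2 D\<close>, and \<open>Q\<close> is positive
  semidefinite. Since all vertices other than \<open>c\<close> have degree at most \<open>2\<close>, this gives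
  \<open>x \<bullet> L x < 4 (x \<bullet> x)\<close> for all nonzero \<open>x\<close> on the hyperplane of vectors that vanish at \<open>c\<close>
  (\<open>laplacian_form_less_if_zero_at_centre\<close>). Two eigenvalues \<open>\<ge> 4\<close> would provide a plane on which
  \<open>x \<bullet> L x \<ge> 4 (x \<bullet> x)\<close>, and a plane meets every
  hyperplane in a nonzero vector (\<open>at_most_one_eigenvalue_ge\<close>).

  At least one: the vector with value \<open>k\<close> at \<open>c\<close>, \<open>-1\<close> at the neighbours of \<open>c\<close> and \<open>0\<close> elsewhere has
  Rayleigh quotient at least \<open>k + 1 \<ge> 4\<close> (\<open>star_test_vector\<close>), and the largest eigenvalue dominates
  every Rayleigh quotient (\<open>eigenvalue_ge_Rayleigh_quotient\<close>).

  The case of equality: if the eigenvalue is \<open>4\<close>, then \<open>k = 3\<close>, and no edge leaves the closed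
  neighbourhood of \<open>c\<close>, as it would increase the Rayleigh quotient. By connectedness there are no
  further vertices, and a tree has no edge between two neighbours of \<open>c\<close>, so it is the claw
  (\<open>digraph_iso_claw\<close>). Conversely, \<open>4\<close> is an eigenvalue of the claw (\<open>claw_eigenvalue_4\<close>).

  Both bounds rest on the spectral theorem for real symmetric matrices, in the form that the roots of
  the characteristic polynomial, with multiplicity, are the diagonal entries of an orthogonal
  diagonalisation (\<open>symmetric_mat_principal_axes\<close>).
\<close>

section \<open>Orthogonal diagonalisation of real symmetric matrices\<close>

lemma scalar_prod_self_eq_sum:
  fixes x :: "real vec"
  assumes "x \<in> carrier_vec n"
  shows "x \<bullet> x = (\<Sum>i<n. (x $ i)\<^sup>2)"
  using assms by (auto simp: scalar_prod_def power2_eq_square lessThan_atLeast0 intro!: sum.cong)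

lemma scalar_prod_self_pos_iff:
  fixes x :: "real vec"
  assumes "x \<in> carrier_vec n"
  shows "x \<bullet> x > 0 \<longleftrightarrow> x \<noteq> 0\<^sub>v n"
proof -
  have "x \<bullet> x = 0 \<longleftrightarrow> x = 0\<^sub>v n"
    using assms by (auto simp: scalar_prod_self_eq_sum[OF assms] sum_nonneg_eq_0_iff)
  moreover have "x \<bullet> x \<ge> 0"
    by (simp add: scalar_prod_self_eq_sum[OF assms] sum_nonneg)
  ultimately show ?thesis by linarith
qed

text \<open>
  Over \<open>\<complex>\<close> there is an eigenvector \<open>x + \<i> y\<close>, with eigenvalue \<open>a + \<i> b\<close>. Comparing \<open>y \<bullet> A x\<close>
  with \<open>A y \<bullet> x\<close> gives \<open>b (x \<bullet> x + y \<bullet> y) = 0\<close>, so \<open>b = 0\<close>, and then \<open>x\<close> or \<open>y\<close> is a real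
  eigenvector.
\<close>

lemma symmetric_mat_real_eigenvector:
  fixes A :: "real mat"
  assumes A: "A \<in> carrier_mat n n" and sym: "transpose_mat A = A" and n: "n > 0"
  obtains v e where "v \<in> carrier_vec n" "v \<bullet> v = 1" "A *\<^sub>v v = e \<cdot>\<^sub>v v"
proof -
  let ?C = "map_mat complex_of_real A"
  have C: "?C \<in> carrier_mat n n" using A by simp
  have "degree (char_poly ?C) = n" using degree_monic_char_poly[OF C] by simp
  then have "\<not> constant (poly (char_poly ?C))"
    using n by (simp add: constant_degree)
  then obtain z where "poly (char_poly ?C) z = 0"
    using fundamental_theorem_of_algebra by blast
  then obtain w where w: "w \<in> carrier_vec n" "w \<noteq> 0\<^sub>v n" "?C *\<^sub>v w = z \<cdot>\<^sub>v w"
    using eigenvalue_root_char_poly[OF C] C unfolding eigenvalue_def eigenvector_def by auto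
  define x y where "x = map_vec Re w" and "y = map_vec Im w"
  have xy: "x \<in> carrier_vec n" "y \<in> carrier_vec n" using w by (auto simp: x_def y_def)
  have comp: "(\<Sum>j<n. complex_of_real (A $$ (i, j)) * w $ j) = z * w $ i" if "i < n" for i
    using arg_cong[OF w(3), of "\<lambda>v. v $ i"] that A w(1)
    by (simp add: scalar_prod_def lessThan_atLeast0)
  have Ax: "A *\<^sub>v x = Re z \<cdot>\<^sub>v x - Im z \<cdot>\<^sub>v y"
  proof (rule eq_vecI)
    fix i assume "i < dim_vec (Re z \<cdot>\<^sub>v x - Im z \<cdot>\<^sub>v y)"
    then have i: "i < n" using xy by auto
    show "(A *\<^sub>v x) $ i = (Re z \<cdot>\<^sub>v x - Im z \<cdot>\<^sub>v y) $ i"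
      using arg_cong[OF comp[OF i], of Re] i A w(1)
      by (simp add: x_def y_def scalar_prod_def lessThan_atLeast0)
  qed (use A xy in auto)
  have Ay: "A *\<^sub>v y = Im z \<cdot>\<^sub>v x + Re z \<cdot>\<^sub>v y"
  proof (rule eq_vecI)
    fix i assume "i < dim_vec (Im z \<cdot>\<^sub>v x + Re z \<cdot>\<^sub>v y)"
    then have i: "i < n" using xy by auto
    show "(A *\<^sub>v y) $ i = (Im z \<cdot>\<^sub>v x + Re z \<cdot>\<^sub>v y) $ i"
      using arg_cong[OF comp[OF i], of Im] i A w(1)
      by (simp add: x_def y_def scalar_prod_def lessThan_atLeast0)
  qed (use A xy in auto)
  have "y \<bullet> (A *\<^sub>v x) = (A *\<^sub>v y) \<bullet> x"
    using transpose_vec_mult_scalar[OF A xy(1) xy(2)] sym by simp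
  then have "Im z * (x \<bullet> x + y \<bullet> y) = 0"
    using xy comm_scalar_prod[OF xy]
    by (simp add: Ax Ay scalar_prod_minus_distrib[of _ n] add_scalar_prod_distrib[of _ n] algebra_simps)
  moreover have nz: "x \<noteq> 0\<^sub>v n \<or> y \<noteq> 0\<^sub>v n"
  proof (rule ccontr)
    assume "\<not> (x \<noteq> 0\<^sub>v n \<or> y \<noteq> 0\<^sub>v n)"
    then have "Re (w $ i) = 0 \<and> Im (w $ i) = 0" if "i < n" for i
      using that w(1) by (auto simp: x_def y_def vec_eq_iff)
    then have "w = 0\<^sub>v n" using w(1) by (auto simp: complex_eq_iff)
    with w(2) show False by simp
  qed
  moreover have "x \<bullet> x \<ge> 0" "y \<bullet> y \<ge> 0"
    by (simp_all add: scalar_prod_self_eq_sum[OF xy(1)] scalar_prod_self_eq_sum[OF xy(2)] sum_nonneg)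
  ultimately have "Im z = 0"
    using scalar_prod_self_pos_iff[OF xy(1)] scalar_prod_self_pos_iff[OF xy(2)] by auto
  then have "A *\<^sub>v x = Re z \<cdot>\<^sub>v x" "A *\<^sub>v y = Re z \<cdot>\<^sub>v y"
    using Ax Ay xy by auto
  with nz xy obtain u where u: "u \<in> carrier_vec n" "u \<noteq> 0\<^sub>v n" "A *\<^sub>v u = Re z \<cdot>\<^sub>v u" by metis
  define s where "s = inverse (sqrt (u \<bullet> u))"
  have "u \<bullet> u > 0" using u scalar_prod_self_pos_iff by blast
  then have "s * s * (u \<bullet> u) = 1"
    by (simp add: s_def flip: inverse_mult_distrib)
  then have "(s \<cdot>\<^sub>v u) \<bullet> (s \<cdot>\<^sub>v u) = 1" using u(1) by (simp add: mult.assoc)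
  moreover have "A *\<^sub>v (s \<cdot>\<^sub>v u) = Re z \<cdot>\<^sub>v (s \<cdot>\<^sub>v u)"
    using u A by (simp add: mult_mat_vec smult_smult_assoc mult.commute)
  ultimately show thesis using that[of "s \<cdot>\<^sub>v u" "Re z"] u(1) by simp
qed

text \<open>
  The Householder reflection \<open>1 - 2 w w\<^sup>T / (w \<bullet> w)\<close> with \<open>w = v - e\<^sub>0\<close> exchanges the unit vectors
  \<open>e\<^sub>0\<close> and \<open>v\<close>. For \<open>v = e\<^sub>0\<close> the convention \<open>2 / 0 = 0\<close> makes the same formula the identity matrix.
\<close>

lemma reflection_with_first_column:
  fixes v :: "real vec"
  assumes v: "v \<in> carrier_vec n" and n: "n > 0" and unit: "v \<bullet> v = 1"
  obtains H where "H \<in> carrier_mat n n" "transpose_mat H = H" "H * H = 1\<^sub>m n" "col H 0 = v"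
proof -
  define w where "w i = v $ i - (if i = 0 then 1 else 0)" for i
  define q where "q = (\<Sum>i<n. w i * w i)"
  define c where "c = 2 / q"
  define H where "H = mat n n (\<lambda>(i, j). (if i = j then 1 else 0) - c * w i * w j)"
  have H: "H \<in> carrier_mat n n" by (simp add: H_def)
  have T: "transpose_mat H = H"
    by (rule eq_matI) (auto simp: H_def)
  have "H * H = 1\<^sub>m n"
  proof (rule eq_matI)
    fix i j assume "i < dim_row (1\<^sub>m n)" "j < dim_col (1\<^sub>m n)"
    then have ij: "i < n" "j < n" by auto
    have "(H * H) $$ (i, j) =
      (\<Sum>k<n. ((if i = k then 1 else 0) - c * w i * w k) * ((if k = j then 1 else 0) - c * w k * w j))"
      using ij by (simp add: H_def scalar_prod_def lessThan_atLeast0)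
    also have "\<dots> = (\<Sum>k<n. (if k = i then (if i = j then 1 else 0) - c * w i * w j else 0)
        - (if k = j then c * w i * w j else 0) + c * c * w i * w j * (w k * w k))"
      by (rule sum.cong) (auto simp: algebra_simps)
    also have "\<dots> = (if i = j then 1 else 0) - c * w i * w j - c * w i * w j + c * c * w i * w j * q"
      using ij by (simp add: sum.distrib sum_subtractf q_def sum_distrib_left)
    also have "c * c * w i * w j * q = 2 * c * w i * w j"
      by (simp add: c_def field_simps)
    finally show "(H * H) $$ (i, j) = 1\<^sub>m n $$ (i, j)" using ij by simp
  qed (use H in auto)
  moreover have "col H 0 = v"
  proof -
    have "q = (\<Sum>i<n. v $ i * v $ i + (if i = 0 then 1 - 2 * v $ 0 else 0))"
      unfolding q_def by (rule sum.cong) (auto simp: w_def algebra_simps)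
    also have "\<dots> = v \<bullet> v + 1 - 2 * v $ 0"
      using n v by (simp add: sum.distrib scalar_prod_def lessThan_atLeast0)
    finally have q: "q = - 2 * w 0" using unit by (simp add: w_def)
    have *: "c * w i * w 0 = - w i" if "i < n" for i
    proof (cases "w 0 = 0")
      case True
      then have "w i * w i = 0"
        using q that sum_nonneg_eq_0_iff[of "{..<n}" "\<lambda>i. w i * w i"] by (auto simp: q_def)
      then show ?thesis by simp
    next
      case False
      then show ?thesis by (simp add: c_def q)
    qed
    show ?thesis
      by (rule eq_vecI) (use n v * in \<open>auto simp: H_def w_def[of "_::nat"] \<close>)
  qed
  ultimately show thesis using that H T by blast
qed

text \<open>
  Conjugating by a reflection that moves a unit eigenvector to \<open>e\<^sub>0\<close> turns the first column into a
  multiple of \<open>e\<^sub>0\<close>; by symmetry so is the first row, and the remaining block is symmetric and of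
  smaller size.
\<close>

theorem symmetric_mat_orthogonally_diagonalizable:
  fixes A :: "real mat"
  assumes "A \<in> carrier_mat n n" "transpose_mat A = A"
  shows "\<exists>P \<in> carrier_mat n n. transpose_mat P * P = 1\<^sub>m n \<and> diagonal_mat (transpose_mat P * A * P)"
  using assms
proof (induction n arbitrary: A)
  case 0
  then show ?case by (intro bexI[of _ "1\<^sub>m 0"]) (auto simp: diagonal_mat_def)
next
  case (Suc n A)
  note A = Suc.prems(1) and sym = Suc.prems(2)
  obtain v e where v: "v \<in> carrier_vec (Suc n)" "v \<bullet> v = 1" "A *\<^sub>v v = e \<cdot>\<^sub>v v"
    using symmetric_mat_real_eigenvector[OF A sym] by blast
  obtain H where H: "H \<in> carrier_mat (Suc n) (Suc n)" "transpose_mat H = H"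
      "H * H = 1\<^sub>m (Suc n)" "col H 0 = v"
    using reflection_with_first_column[OF v(1) _ v(2)] by blast
  define B where "B = H * A * H"
  have B: "B \<in> carrier_mat (Suc n) (Suc n)" using H A by (simp add: B_def)
  have symB: "transpose_mat B = B"
    using H A sym by (simp add: B_def transpose_mult[of _ "Suc n" "Suc n" _ "Suc n"] assoc_mult_mat[of _ "Suc n" "Suc n" _ "Suc n" _ "Suc n"])
  have Hv: "H *\<^sub>v v = unit_vec (Suc n) 0"
  proof -
    have "H *\<^sub>v v = col (H * H) 0"
      using H(4) by (simp add: col_mult2[OF H(1) H(1)])
    then show ?thesis using H(3) by simp
  qed
  have colB: "col B 0 = e \<cdot>\<^sub>v unit_vec (Suc n) 0"
  proof -
    have "col B 0 = (H * A) *\<^sub>v col H 0"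
      unfolding B_def by (rule col_mult2[of _ "Suc n" "Suc n" _ "Suc n"]) (use H(1) A in auto)
    also have "\<dots> = (H * A) *\<^sub>v v" by (simp only: H(4))
    also have "\<dots> = H *\<^sub>v (e \<cdot>\<^sub>v v)" using assoc_mult_mat_vec[OF H(1) A v(1)] v(3) by simp
    also have "\<dots> = e \<cdot>\<^sub>v (H *\<^sub>v v)" using H v by (simp add: mult_mat_vec)
    finally show ?thesis by (simp add: Hv)
  qed
  have B0: "B $$ (i, 0) = (if i = 0 then e else 0)" if "i < Suc n" for i
    using arg_cong[OF colB, of "\<lambda>u. u $ i"] B that by auto
  have Bsym: "B $$ (i, j) = B $$ (j, i)" if "i < Suc n" "j < Suc n" for i j
    using arg_cong[OF symB, of "\<lambda>M. M $$ (i, j)"] B that by auto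
  define E where "E = mat 1 1 (\<lambda>_. e)"
  define C where "C = mat n n (\<lambda>(i, j). B $$ (Suc i, Suc j))"
  have E: "E \<in> carrier_mat 1 1" and C: "C \<in> carrier_mat n n" by (simp_all add: E_def C_def)
  have blockB: "B = four_block_mat E (0\<^sub>m 1 n) (0\<^sub>m n 1) C"
    by (rule eq_matI) (use B B0 Bsym[of 0] in \<open>auto simp: E_def C_def\<close>)
  have "transpose_mat C = C"
    by (rule eq_matI) (auto simp: C_def Bsym)
  from Suc.IH[OF C this] obtain P where P: "P \<in> carrier_mat n n" "transpose_mat P * P = 1\<^sub>m n"
    "diagonal_mat (transpose_mat P * C * P)" by blast
  define Q where "Q = four_block_mat (1\<^sub>m 1) (0\<^sub>m 1 n) (0\<^sub>m n 1) P"
  have Q: "Q \<in> carrier_mat (Suc n) (Suc n)"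
    using four_block_carrier_mat[of "1\<^sub>m 1" 1 1 P n n] P by (simp add: Q_def)
  have QT: "transpose_mat Q = four_block_mat (1\<^sub>m 1) (0\<^sub>m 1 n) (0\<^sub>m n 1) (transpose_mat P)"
    unfolding Q_def using P(1) by (subst transpose_four_block_mat[of _ 1 1 _ n _ n]) auto
  have QQ: "transpose_mat Q * Q = 1\<^sub>m (Suc n)"
  proof -
    have "transpose_mat Q * Q = four_block_mat (1\<^sub>m 1) (0\<^sub>m 1 n) (0\<^sub>m n 1) (transpose_mat P * P)"
      unfolding QT unfolding Q_def using P(1)
      by (subst mult_four_block_mat[of _ 1 1 _ n _ n _ _ 1 _ n]) auto
    then show ?thesis unfolding P(2) four_block_one_mat by simp
  qed
  have QBQ: "transpose_mat Q * B * Q = four_block_mat E (0\<^sub>m 1 n) (0\<^sub>m n 1) (transpose_mat P * C * P)"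
  proof -
    have "transpose_mat Q * B = four_block_mat E (0\<^sub>m 1 n) (0\<^sub>m n 1) (transpose_mat P * C)"
      unfolding QT blockB using P E C
      by (subst mult_four_block_mat[of _ 1 1 _ n _ n _ _ 1 _ n]) auto
    moreover have "\<dots> * Q = four_block_mat E (0\<^sub>m 1 n) (0\<^sub>m n 1) (transpose_mat P * C * P)"
      unfolding Q_def using P E C
      by (subst mult_four_block_mat[of _ 1 1 _ n _ n _ _ 1 _ n]) auto
    ultimately show ?thesis by simp
  qed
  have HQ: "H * Q \<in> carrier_mat (Suc n) (Suc n)" using H Q by simp
  note assoc = assoc_mult_mat[of _ "Suc n" "Suc n" _ "Suc n" _ "Suc n"]
  have T: "transpose_mat (H * Q) = transpose_mat Q * H"
    using H Q by (simp add: transpose_mult[of _ "Suc n" "Suc n" _ "Suc n"])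
  have "transpose_mat (H * Q) * (H * Q) = transpose_mat Q * ((H * H) * Q)"
    unfolding T using H(1) Q by (simp add: assoc)
  then have "transpose_mat (H * Q) * (H * Q) = 1\<^sub>m (Suc n)"
    using H Q QQ by simp
  moreover have "transpose_mat (H * Q) * A * (H * Q) = transpose_mat Q * B * Q"
    unfolding T B_def using H(1) Q A by (simp add: assoc)
  moreover have "diagonal_mat (transpose_mat Q * B * Q)"
    unfolding QBQ using P C E by (auto simp: diagonal_mat_def)
  ultimately show ?case using HQ by metis
qed


section \<open>Quadratic forms and the counting of eigenvalues\<close>

lemma proots_prod_list_linear:
  "proots (\<Prod>a \<leftarrow> as. [:- a, 1:]) = mset (as :: real list)"
proof (induction as)
  case (Cons a as)
  have "(\<Prod>a \<leftarrow> as. [:- a, 1:]) \<noteq> 0" by (auto simp: prod_list_zero_iff)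
  then show ?case using Cons by (simp add: proots_mult del: mult_pCons_left)
qed simp

text \<open>
  The form in which the spectral theorem is used: in the coordinates \<open>y\<close> of an orthonormal eigenbasis
  the quadratic form is \<open>\<Sum>i. d i * (y $ i)\<^sup>2\<close>, and the \<open>d i\<close> are the roots of the characteristic
  polynomial with the right multiplicity.
\<close>

lemma symmetric_mat_principal_axes:
  fixes A :: "real mat"
  assumes A: "A \<in> carrier_mat n n" and sym: "transpose_mat A = A"
  obtains P d where "P \<in> carrier_mat n n" "P * transpose_mat P = 1\<^sub>m n"
    "eigenvalue_mset A = image_mset d (mset_set {..<n})"
    "\<And>y. y \<in> carrier_vec n \<Longrightarrow> (P *\<^sub>v y) \<bullet> (A *\<^sub>v (P *\<^sub>v y)) = (\<Sum>i<n. d i * (y $ i)\<^sup>2)"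
    "\<And>y. y \<in> carrier_vec n \<Longrightarrow> (P *\<^sub>v y) \<bullet> (P *\<^sub>v y) = (\<Sum>i<n. (y $ i)\<^sup>2)"
proof -
  obtain P where P: "P \<in> carrier_mat n n" "transpose_mat P * P = 1\<^sub>m n"
    "diagonal_mat (transpose_mat P * A * P)"
    using symmetric_mat_orthogonally_diagonalizable[OF assms] by blast
  define D where "D = transpose_mat P * A * P"
  define d where "d = (\<lambda>i. D $$ (i, i))"
  have T: "transpose_mat P \<in> carrier_mat n n" using P by simp
  have D: "D \<in> carrier_mat n n" using P A by (simp add: D_def)
  have PPT: "P * transpose_mat P = 1\<^sub>m n"
    using mat_mult_left_right_inverse[OF T P(1,2)] .
  have "similar_mat_wit D A (transpose_mat P) P"
    by (rule similar_mat_witI[OF P(2) PPT D_def D A T P(1)])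
  then have "similar_mat D A" unfolding similar_mat_def by blast
  then have "char_poly A = char_poly D" by (rule char_poly_similar[symmetric])
  also have "\<dots> = (\<Prod>a \<leftarrow> diag_mat D. [:- a, 1:])"
    using P(3)[folded D_def] D
    by (intro char_poly_upper_triangular[of _ n]) (auto simp: diagonal_mat_def)
  finally have "eigenvalue_mset A = mset (diag_mat D)"
    by (simp add: eigenvalue_mset_def proots_prod_list_linear)
  also have "\<dots> = image_mset d (mset_set {..<n})"
    using D by (simp add: diag_mat_def d_def lessThan_atLeast0)
  finally have ev: "eigenvalue_mset A = image_mset d (mset_set {..<n})" .
  have form: "(P *\<^sub>v y) \<bullet> (M *\<^sub>v (P *\<^sub>v y)) = y \<bullet> ((transpose_mat P * M * P) *\<^sub>v y)"
    if "y \<in> carrier_vec n" "M \<in> carrier_mat n n" for y M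
  proof -
    have "(P *\<^sub>v y) \<bullet> (M *\<^sub>v (P *\<^sub>v y)) = y \<bullet> (transpose_mat P *\<^sub>v (M *\<^sub>v (P *\<^sub>v y)))"
      using transpose_vec_mult_scalar[of "transpose_mat P" n n "M *\<^sub>v (P *\<^sub>v y)" y] that P(1) by simp
    also have "transpose_mat P *\<^sub>v (M *\<^sub>v (P *\<^sub>v y)) = (transpose_mat P * M * P) *\<^sub>v y"
      using that P(1) T by (simp add: assoc_mult_mat_vec[of _ n n _ n])
    finally show ?thesis .
  qed
  show thesis
  proof (rule that[OF P(1) PPT ev])
    fix y :: "real vec" assume y: "y \<in> carrier_vec n"
    have "(D *\<^sub>v y) $ i = d i * y $ i" if i: "i < n" for i
    proof -
      have "(D *\<^sub>v y) $ i = (\<Sum>j<n. D $$ (i, j) * y $ j)"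
        using i D y by (simp add: scalar_prod_def lessThan_atLeast0)
      also have "\<dots> = (\<Sum>j<n. if j = i then d i * y $ i else 0)"
        using P(3)[folded D_def] D i by (intro sum.cong) (auto simp: diagonal_mat_def d_def)
      finally show ?thesis using i by simp
    qed
    then have "y \<bullet> (D *\<^sub>v y) = (\<Sum>i<n. d i * (y $ i)\<^sup>2)"
      using D y by (auto simp: scalar_prod_def lessThan_atLeast0 power2_eq_square intro!: sum.cong)
    then show "(P *\<^sub>v y) \<bullet> (A *\<^sub>v (P *\<^sub>v y)) = (\<Sum>i<n. d i * (y $ i)\<^sup>2)"
      using form[OF y A] by (simp add: D_def)
    show "(P *\<^sub>v y) \<bullet> (P *\<^sub>v y) = (\<Sum>i<n. (y $ i)\<^sup>2)"
      using form[OF y one_carrier_mat] P y T scalar_prod_self_eq_sum[OF y] by simp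
  qed
qed

lemma eigenvalue_ge_Rayleigh_quotient:
  fixes A :: "real mat"
  assumes A: "A \<in> carrier_mat n n" and sym: "transpose_mat A = A"
    and x: "x \<in> carrier_vec n" and n: "n > 0"
  shows "\<exists>\<mu> \<in># eigenvalue_mset A. x \<bullet> (A *\<^sub>v x) \<le> \<mu> * (x \<bullet> x)"
proof -
  obtain P d where P: "P \<in> carrier_mat n n" "P * transpose_mat P = 1\<^sub>m n"
    and ev: "eigenvalue_mset A = image_mset d (mset_set {..<n})"
    and form: "\<And>y. y \<in> carrier_vec n \<Longrightarrow> (P *\<^sub>v y) \<bullet> (A *\<^sub>v (P *\<^sub>v y)) = (\<Sum>i<n. d i * (y $ i)\<^sup>2)"
    and norm: "\<And>y. y \<in> carrier_vec n \<Longrightarrow> (P *\<^sub>v y) \<bullet> (P *\<^sub>v y) = (\<Sum>i<n. (y $ i)\<^sup>2)"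
    using symmetric_mat_principal_axes[OF A sym] by blast
  define y where "y = transpose_mat P *\<^sub>v x"
  have y: "y \<in> carrier_vec n" using P x by (simp add: y_def)
  have Py: "P *\<^sub>v y = x"
    using assoc_mult_mat_vec[of P n n "transpose_mat P" n x] P x by (simp add: y_def)
  define \<mu> where "\<mu> = Max (d ` {..<n})"
  have "\<mu> \<in> d ` {..<n}" unfolding \<mu>_def using n by (intro Max_in) auto
  then have "\<mu> \<in># eigenvalue_mset A" by (simp add: ev)
  moreover have "d i \<le> \<mu>" if "i < n" for i
    unfolding \<mu>_def using that by (intro Max_ge) auto
  then have "(\<Sum>i<n. d i * (y $ i)\<^sup>2) \<le> (\<Sum>i<n. \<mu> * (y $ i)\<^sup>2)"
    by (intro sum_mono mult_right_mono) auto
  then have "x \<bullet> (A *\<^sub>v x) \<le> \<mu> * (x \<bullet> x)"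
    using form[OF y] norm[OF y] by (simp add: Py sum_distrib_left)
  ultimately show ?thesis by blast
qed

text \<open>
  Two eigenvalues \<open>\<ge> t\<close>, equal or not, belong to two orthonormal eigenvectors. Their plane meets the
  hyperplane \<open>x $ c = 0\<close> in a nonzero vector, at which the quadratic form is still at least
  \<open>t * (x \<bullet> x)\<close>.
\<close>

lemma at_most_one_eigenvalue_ge:
  fixes A :: "real mat"
  assumes A: "A \<in> carrier_mat n n" and sym: "transpose_mat A = A" and c: "c < n"
    and less: "\<And>x. x \<in> carrier_vec n \<Longrightarrow> x \<noteq> 0\<^sub>v n \<Longrightarrow> x $ c = 0 \<Longrightarrow> x \<bullet> (A *\<^sub>v x) < t * (x \<bullet> x)"
  shows "size (filter_mset (\<lambda>\<mu>. \<mu> \<ge> t) (eigenvalue_mset A)) \<le> 1"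
proof -
  obtain P d where P: "P \<in> carrier_mat n n" "P * transpose_mat P = 1\<^sub>m n"
    and ev: "eigenvalue_mset A = image_mset d (mset_set {..<n})"
    and form: "\<And>y. y \<in> carrier_vec n \<Longrightarrow> (P *\<^sub>v y) \<bullet> (A *\<^sub>v (P *\<^sub>v y)) = (\<Sum>i<n. d i * (y $ i)\<^sup>2)"
    and norm: "\<And>y. y \<in> carrier_vec n \<Longrightarrow> (P *\<^sub>v y) \<bullet> (P *\<^sub>v y) = (\<Sum>i<n. (y $ i)\<^sup>2)"
    using symmetric_mat_principal_axes[OF A sym] by blast
  have "i = j" if ij: "i < n" "j < n" and ge: "d i \<ge> t" "d j \<ge> t" for i j
  proof (rule ccontr)
    assume neq: "i \<noteq> j"
    \<comment> \<open>coefficients of a combination of columns \<open>i\<close> and \<open>j\<close> of \<open>P\<close> that vanishes at \<open>c\<close>\<close>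
    obtain a b where ab: "a * P $$ (c, i) + b * P $$ (c, j) = 0" "a \<noteq> 0 \<or> b \<noteq> 0"
    proof (cases "P $$ (c, i) = 0 \<and> P $$ (c, j) = 0")
      case True
      then show ?thesis using that[of 1 0] by simp
    next
      case False
      then show ?thesis using that[of "P $$ (c, j)" "- P $$ (c, i)"] by auto
    qed
    define y where "y = vec n (\<lambda>k. (if k = i then a else 0) + (if k = j then b else 0))"
    have y: "y \<in> carrier_vec n" by (simp add: y_def)
    have sumy: "(\<Sum>k<n. g k * (y $ k)\<^sup>2) = g i * a\<^sup>2 + g j * b\<^sup>2" for g :: "nat \<Rightarrow> real"
    proof -
      have "(\<Sum>k<n. g k * (y $ k)\<^sup>2) =
        (\<Sum>k<n. (if k = i then g i * a\<^sup>2 else 0) + (if k = j then g j * b\<^sup>2 else 0))"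
        using neq by (intro sum.cong) (auto simp: y_def)
      then show ?thesis using ij by (simp add: sum.distrib)
    qed
    let ?x = "P *\<^sub>v y"
    have x: "?x \<in> carrier_vec n" using P y by simp
    have norm': "?x \<bullet> ?x = a\<^sup>2 + b\<^sup>2"
      using norm[OF y] sumy[of "\<lambda>_. 1"] by simp
    then have "?x \<bullet> ?x > 0" using ab(2) by (simp add: sum_power2_gt_zero_iff)
    then have "?x \<noteq> 0\<^sub>v n" using scalar_prod_self_pos_iff[OF x] by simp
    moreover have "?x $ c = (\<Sum>k<n. (if k = i then a * P $$ (c, i) else 0) + (if k = j then b * P $$ (c, j) else 0))"
      using P c by (auto simp: y_def scalar_prod_def lessThan_atLeast0 algebra_simps intro!: sum.cong)
    then have "?x $ c = 0" using ij ab(1) by (simp add: sum.distrib)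
    ultimately have "?x \<bullet> (A *\<^sub>v ?x) < t * (?x \<bullet> ?x)" using less x by blast
    then have "d i * a\<^sup>2 + d j * b\<^sup>2 < t * a\<^sup>2 + t * b\<^sup>2"
      using form[OF y] sumy[of d] norm' by (simp add: algebra_simps)
    moreover have "t * a\<^sup>2 \<le> d i * a\<^sup>2" "t * b\<^sup>2 \<le> d j * b\<^sup>2"
      using ge by (simp_all add: mult_right_mono)
    ultimately show False by linarith
  qed
  then have "card {i \<in> {..<n}. d i \<ge> t} \<le> 1"
    by (auto simp: card_le_Suc0_iff_eq)
  then show ?thesis
    by (simp add: ev filter_mset_image_mset filter_mset_mset_set)
qed

section \<open>Neighbours and connectedness\<close>

definition neighbours :: "'a pair_pre_digraph \<Rightarrow> 'a \<Rightarrow> 'a set" where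
  "neighbours G v = {u. (v, u) \<in> parcs G}"

lemma vertex_degree_eq_card_neighbours: "vertex_degree G v = card (neighbours G v)"
proof -
  have "out_arcs (with_proj G) v = Pair v ` neighbours G v"
    by (auto simp: out_arcs_def neighbours_def)
  then show ?thesis
    by (simp add: vertex_degree_def out_degree_def card_image inj_on_def)
qed

context pair_graph
begin

lemma arc_sym: "(u, v) \<in> parcs G \<longleftrightarrow> (v, u) \<in> parcs G"
  using arcs_symmetric by auto

lemma neighbours_subset: "neighbours G v \<subseteq> pverts G"
  by (auto simp: neighbours_def dest: in_arcsD2)

lemma finite_neighbours [simp]: "finite (neighbours G v)"
  using finite_subset[OF neighbours_subset] by simp

lemma no_loop: "(v, v) \<notin> parcs G"
  using no_loops[of "(v, v)"] by auto

lemma not_self_neighbour: "v \<notin> neighbours G v"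
  by (simp add: neighbours_def no_loop)

lemma sum_over_neighbours:
  fixes h :: "'a \<Rightarrow> 'a \<Rightarrow> real"
  shows "(\<Sum>v\<in>pverts G. \<Sum>u\<in>neighbours G v. h v u) = (\<Sum>(v, u)\<in>parcs G. h v u)"
proof -
  have "Sigma (pverts G) (neighbours G) = parcs G"
    by (auto simp: neighbours_def dest: in_arcsD1)
  then show ?thesis by (simp add: sum.Sigma)
qed

lemma sum_arcs_flip:
  fixes h :: "'a \<Rightarrow> 'a \<Rightarrow> real"
  shows "(\<Sum>(v, u)\<in>parcs G. h v u) = (\<Sum>(v, u)\<in>parcs G. h u v)"
  by (rule sum.reindex_bij_witness[of _ prod.swap prod.swap]) (auto simp: arc_sym)

lemma connected_closed_set:
  assumes conn: "Digraph_Component.connected (with_proj G)"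
    and c: "c \<in> pverts G" "c \<in> S"
    and closed: "\<And>u v. (u, v) \<in> parcs G \<Longrightarrow> u \<in> S \<Longrightarrow> v \<in> S"
  shows "pverts G \<subseteq> S"
proof
  fix v assume "v \<in> pverts G"
  then have "c \<rightarrow>\<^sup>*\<^bsub>with_proj (mk_symmetric (with_proj G))\<^esub> v"
    using conn c by (auto simp: Digraph_Component.connected_def strongly_connected_def)
  then have "c \<rightarrow>\<^sup>*\<^bsub>with_proj G\<^esub> v"
    using reachable_mk_symmetric_eq sym_arcs by blast
  then show "v \<in> S"
    by (induction rule: reachable_induct) (use c closed in auto)
qed

end

section \<open>The quadratic form of the Laplacian\<close>

locale numbered_graph = pair_graph G for G :: "'a pair_pre_digraph" +
  fixes vs :: "'a list"
  assumes distinct_numbering: "distinct vs" and set_numbering: "set vs = pverts G"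
begin

abbreviation n :: nat where "n \<equiv> length vs"
abbreviation L :: "real mat" where "L \<equiv> laplacian G vs"

text \<open>
  Vectors are handled as functions on the vertices, so that sums over indices become sums over
  vertices and arcs.
\<close>

definition vec_of :: "('a \<Rightarrow> real) \<Rightarrow> real vec" where
  "vec_of f = vec n (\<lambda>i. f (vs ! i))"

lemma vec_of_carrier [simp]: "vec_of f \<in> carrier_vec n"
  by (simp add: vec_of_def)

lemma vec_of_surj:
  assumes "x \<in> carrier_vec n"
  obtains f where "x = vec_of f"
proof
  show "x = vec_of (\<lambda>v. x $ the_inv_into {..<n} ((!) vs) v)"
    using assms distinct_numbering
    by (auto simp: vec_of_def the_inv_into_f_f[OF inj_on_nth] intro!: eq_vecI)
qed

lemma sum_numbering: "(\<Sum>i<n. h (vs ! i)) = (\<Sum>v\<in>pverts G. h v)"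
  using sum.reindex_bij_betw[OF bij_betw_nth[OF distinct_numbering refl set_numbering[symmetric]], of h]
  by simp

lemma scalar_prod_vec_of: "vec_of f \<bullet> vec_of g = (\<Sum>v\<in>pverts G. f v * g v)"
  by (simp add: vec_of_def scalar_prod_def sum_numbering[symmetric] lessThan_atLeast0)

lemma laplacian_carrier [simp]: "L \<in> carrier_mat n n"
  by (simp add: laplacian_def degree_matrix_def adjacency_matrix_def minus_carrier_mat)

lemma laplacian_dims [simp]: "dim_row L = n" "dim_col L = n"
  using laplacian_carrier by blast+

lemma laplacian_symmetric: "transpose_mat L = L"
  by (rule eq_matI) (auto simp: laplacian_def degree_matrix_def adjacency_matrix_def arc_sym)

lemma laplacian_mult_vec_of:
  "L *\<^sub>v vec_of f = vec_of (\<lambda>v. \<Sum>u\<in>neighbours G v. f v - f u)"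
proof (rule eq_vecI)
  fix i assume "i < dim_vec (vec_of (\<lambda>v. \<Sum>u\<in>neighbours G v. f v - f u))"
  then have i: "i < n" by (simp add: vec_of_def)
  define v where "v = vs ! i"
  have "(L *\<^sub>v vec_of f) $ i = (\<Sum>j<n. L $$ (i, j) * f (vs ! j))"
    using i by (simp add: vec_of_def scalar_prod_def lessThan_atLeast0)
  also have "\<dots> = (\<Sum>j<n. (if vs ! j = v then vertex_degree G v * f v else 0)
      - (if vs ! j \<in> neighbours G v then f (vs ! j) else 0))"
    using i distinct_numbering
    by (intro sum.cong)
       (auto simp: laplacian_def degree_matrix_def adjacency_matrix_def neighbours_def v_def
          nth_eq_iff_index_eq no_loop)
  also have "\<dots> = (\<Sum>u\<in>pverts G. (if u = v then vertex_degree G v * f v else 0)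
      - (if u \<in> neighbours G v then f u else 0))"
    by (rule sum_numbering)
  also have "\<dots> = vertex_degree G v * f v - (\<Sum>u\<in>neighbours G v. f u)"
  proof -
    have "v \<in> pverts G" using nth_mem[OF i] by (simp only: v_def set_numbering)
    moreover have "(\<Sum>u\<in>pverts G. if u \<in> neighbours G v then f u else 0) = (\<Sum>u\<in>neighbours G v. f u)"
      using neighbours_subset[of v] by (simp add: sum.inter_restrict[symmetric] Int_absorb1)
    ultimately show ?thesis by (simp add: sum_subtractf)
  qed
  also have "\<dots> = (\<Sum>u\<in>neighbours G v. f v - f u)"
    by (simp add: sum_subtractf vertex_degree_eq_card_neighbours)
  finally show "(L *\<^sub>v vec_of f) $ i = vec_of (\<lambda>v. \<Sum>u\<in>neighbours G v. f v - f u) $ i"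
    using i by (simp add: vec_of_def v_def)
qed (simp add: vec_of_def)

abbreviation laplacian_form :: "('a \<Rightarrow> real) \<Rightarrow> real" where
  "laplacian_form f \<equiv> vec_of f \<bullet> (L *\<^sub>v vec_of f)"

text \<open>
  The factor \<open>2\<close> appears because each edge is a pair of opposite arcs.
\<close>

lemma laplacian_form_eq_arc_sum:
  "2 * laplacian_form f = (\<Sum>(v, u)\<in>parcs G. (f v - f u)\<^sup>2)"
proof -
  have "laplacian_form f = (\<Sum>(v, u)\<in>parcs G. f v * (f v - f u))"
    by (simp add: laplacian_mult_vec_of scalar_prod_vec_of sum_distrib_left sum_over_neighbours)
  moreover from this have "laplacian_form f = (\<Sum>(v, u)\<in>parcs G. f u * (f u - f v))"
    using sum_arcs_flip[of "\<lambda>v u. f v * (f v - f u)"] by simp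
  ultimately have "2 * laplacian_form f =
      (\<Sum>(v, u)\<in>parcs G. f v * (f v - f u)) + (\<Sum>(v, u)\<in>parcs G. f u * (f u - f v))"
    by linarith
  also have "\<dots> = (\<Sum>(v, u)\<in>parcs G. (f v - f u)\<^sup>2)"
    unfolding sum.distrib[symmetric]
    by (rule sum.cong) (auto simp: power2_eq_square algebra_simps)
  finally show ?thesis .
qed

text \<open>
  The Laplacian \<open>D - A\<close> and the signless Laplacian \<open>D + A\<close> add up to \<open>2 D\<close>, and the form of the
  latter is a sum of squares. This turns bounds on degrees into upper bounds on the Laplacian.
\<close>

lemma laplacian_form_signless:
  fixes f :: "'a \<Rightarrow> real"
  shows "2 * laplacian_form f + (\<Sum>(v, u)\<in>parcs G. (f v + f u)\<^sup>2)
    = 4 * (\<Sum>v\<in>pverts G. real (vertex_degree G v) * (f v)\<^sup>2)"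
proof -
  have "2 * laplacian_form f + (\<Sum>(v, u)\<in>parcs G. (f v + f u)\<^sup>2)
      = 2 * (\<Sum>(v, u)\<in>parcs G. (f v)\<^sup>2) + 2 * (\<Sum>(v, u)\<in>parcs G. (f u)\<^sup>2)"
    unfolding laplacian_form_eq_arc_sum sum_distrib_left sum.distrib[symmetric]
    by (rule sum.cong) (auto simp: power2_sum power2_diff)
  also have "\<dots> = 4 * (\<Sum>(v, u)\<in>parcs G. (f v)\<^sup>2)"
    using sum_arcs_flip[of "\<lambda>v u. (f v)\<^sup>2"] by simp
  also have "(\<Sum>(v, u)\<in>parcs G. (f v)\<^sup>2) = (\<Sum>v\<in>pverts G. real (vertex_degree G v) * (f v)\<^sup>2)"
    unfolding sum_over_neighbours[symmetric] by (simp add: vertex_degree_eq_card_neighbours)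
  finally show ?thesis .
qed

text \<open>
  Where all degrees are at most \<open>2\<close>, the signless identity bounds the form by \<open>4\<close> times the squared
  norm, and the vertex \<open>c\<close>, of whatever degree, contributes nothing as \<open>f c = 0\<close>. The bound is strict
  because the signless form vanishes only if \<open>f v = - f u\<close> along every edge, and by connectedness
  this spreads the value \<open>0\<close> from \<open>c\<close> to all vertices.
\<close>

lemma laplacian_form_less_if_zero_at_centre:
  assumes conn: "Digraph_Component.connected (with_proj G)"
    and c: "c \<in> pverts G" "f c = 0"
    and deg: "\<And>v. v \<in> pverts G \<Longrightarrow> v \<noteq> c \<Longrightarrow> vertex_degree G v \<le> 2"
    and nz: "vec_of f \<noteq> 0\<^sub>v n"
  shows "laplacian_form f < 4 * (vec_of f \<bullet> vec_of f)"
proof -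
  define S where "S = (\<Sum>(v, u)\<in>parcs G. (f v + f u)\<^sup>2)"
  have "S > 0"
  proof (rule ccontr)
    assume "\<not> S > 0"
    moreover have "S \<ge> 0" unfolding S_def by (rule sum_nonneg) auto
    ultimately have "S = 0" by linarith
    then have "\<forall>(v, u)\<in>parcs G. (f v + f u)\<^sup>2 = 0"
      unfolding S_def by (subst (asm) sum_nonneg_eq_0_iff) (auto split: prod.splits)
    then have "pverts G \<subseteq> {v. f v = 0}"
      by (intro connected_closed_set[OF conn c(1)]) (use c(2) in auto)
    then have "vec_of f = 0\<^sub>v n"
      using set_numbering nth_mem by (fastforce simp: vec_of_def intro!: eq_vecI)
    with nz show False by simp
  qed
  moreover have "(\<Sum>v\<in>pverts G. real (vertex_degree G v) * (f v)\<^sup>2) \<le> (\<Sum>v\<in>pverts G. 2 * (f v)\<^sup>2)"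
  proof (rule sum_mono)
    fix v assume "v \<in> pverts G"
    then show "real (vertex_degree G v) * (f v)\<^sup>2 \<le> 2 * (f v)\<^sup>2"
      using deg[of v] c(2) by (cases "v = c") (auto intro!: mult_right_mono)
  qed
  then have "4 * (\<Sum>v\<in>pverts G. real (vertex_degree G v) * (f v)\<^sup>2) \<le> 8 * (vec_of f \<bullet> vec_of f)"
    by (simp add: scalar_prod_vec_of sum_distrib_left[symmetric] power2_eq_square)
  moreover have "2 * laplacian_form f + S = 4 * (\<Sum>v\<in>pverts G. real (vertex_degree G v) * (f v)\<^sup>2)"
    using laplacian_form_signless[of f] by (simp only: S_def)
  ultimately show ?thesis by linarith
qed

text \<open>
  The test vector is the top eigenvector of the star with \<open>k\<close> leaves: \<open>k\<close> at the centre and \<open>-1\<close>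
  at the neighbours, extended by \<open>0\<close>. The arcs at \<open>c\<close> alone yield the Rayleigh quotient \<open>k + 1\<close>, and
  every edge leaving the closed neighbourhood of \<open>c\<close> adds a positive amount.
\<close>

lemma star_test_vector:
  assumes c: "c \<in> pverts G" and k: "vertex_degree G c = k" "k > 0"
  obtains f where "vec_of f \<bullet> vec_of f > 0"
    "laplacian_form f \<ge> (real k + 1) * (vec_of f \<bullet> vec_of f)"
    "laplacian_form f \<le> (real k + 1) * (vec_of f \<bullet> vec_of f) \<longrightarrow>
       (\<forall>u \<in> neighbours G c. neighbours G u \<subseteq> insert c (neighbours G c))"
proof -
  define N where "N = neighbours G c"
  define f where "f v = (if v = c then real k else if v \<in> N then - 1 else 0)" for v
  have N: "finite N" "N \<subseteq> pverts G" "c \<notin> N" "card N = k"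
    using neighbours_subset not_self_neighbour k by (auto simp: N_def vertex_degree_eq_card_neighbours)
  have arcN: "(c, u) \<in> parcs G" "(u, c) \<in> parcs G" if "u \<in> N" for u
    using that arc_sym by (auto simp: N_def neighbours_def)
  have "(\<Sum>v\<in>pverts G. f v * f v) = (\<Sum>v\<in>insert c N. f v * f v)"
    using N c by (intro sum.mono_neutral_right) (auto simp: f_def)
  also have "\<dots> = f c * f c + (\<Sum>v\<in>N. f v * f v)"
    using N by simp
  also have "(\<Sum>v\<in>N. f v * f v) = (\<Sum>v\<in>N. 1)"
    using N(3) by (intro sum.cong) (auto simp: f_def)
  finally have norm: "vec_of f \<bullet> vec_of f = real k * (real k + 1)"
    using N(4) by (simp add: scalar_prod_vec_of f_def algebra_simps)
  \<comment> \<open>the arcs at \<open>c\<close>, whose contribution is bounded separately\<close>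
  define E where "E = Pair c ` N \<union> (\<lambda>u. (u, c)) ` N"
  have E: "finite E" "E \<subseteq> parcs G" using N arcN by (auto simp: E_def)
  have sumE: "(\<Sum>(v, u)\<in>E. (f v - f u)\<^sup>2) = 2 * ((real k + 1) * (vec_of f \<bullet> vec_of f))"
  proof -
    have "(\<Sum>(v, u)\<in>E. (f v - f u)\<^sup>2) = (\<Sum>e\<in>E. (real k + 1)\<^sup>2)"
      using N by (intro sum.cong) (auto simp: E_def f_def power2_eq_square algebra_simps)
    moreover have "card E = 2 * k"
      unfolding E_def using N by (subst card_Un_disjoint) (auto simp: card_image inj_on_def)
    ultimately show ?thesis by (simp add: norm power2_eq_square)
  qed
  have le: "2 * ((real k + 1) * (vec_of f \<bullet> vec_of f)) + (\<Sum>(v, u)\<in>E'. (f v - f u)\<^sup>2) \<le> 2 * laplacian_form f"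
    if "E' \<subseteq> parcs G" "E' \<inter> E = {}" for E'
  proof -
    have fin: "finite E'" using finite_subset[OF that(1) pair_finite_arcs] .
    have "(\<Sum>(v, u)\<in>E \<union> E'. (f v - f u)\<^sup>2) \<le> (\<Sum>(v, u)\<in>parcs G. (f v - f u)\<^sup>2)"
      using E that by (intro sum_mono2) auto
    then show ?thesis
      unfolding laplacian_form_eq_arc_sum sumE[symmetric]
      using E fin that by (subst (asm) sum.union_disjoint) auto
  qed
  show thesis
  proof (rule that)
    show "vec_of f \<bullet> vec_of f > 0" using k(2) by (simp add: norm)
    show "laplacian_form f \<ge> (real k + 1) * (vec_of f \<bullet> vec_of f)"
      using le[of "{}"] by simp
    show "laplacian_form f \<le> (real k + 1) * (vec_of f \<bullet> vec_of f) \<longrightarrow>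
       (\<forall>u \<in> neighbours G c. neighbours G u \<subseteq> insert c (neighbours G c))"
    proof (intro impI ballI subsetI, rule ccontr)
      fix u w
      assume small: "laplacian_form f \<le> (real k + 1) * (vec_of f \<bullet> vec_of f)"
        and uw: "u \<in> neighbours G c" "w \<in> neighbours G u" "w \<notin> insert c (neighbours G c)"
      then have "u \<noteq> c" "(u, w) \<in> parcs G"
        using not_self_neighbour[of c] by (auto simp: neighbours_def)
      with uw have "(f u - f w)\<^sup>2 = 1" "(u, w) \<notin> E"
        by (auto simp: f_def N_def E_def)
      then show False
        using le[of "{(u, w)}"] \<open>(u, w) \<in> parcs G\<close> small by simp
    qed
  qed
qed

end

section \<open>Recognising the claw\<close>

text \<open>
  Such an arc would close a triangle. Triangles have to be excluded explicitly: attaching a pendant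
  vertex to a triangle also gives a graph with one vertex of degree \<open>3\<close>, all other degrees at most
  \<open>2\<close>, and largest Laplacian eigenvalue \<open>4\<close>.
\<close>

lemma (in pair_graph) no_arc_between_neighbours:
  assumes tree: "undirected_tree G" and "u \<in> neighbours G c" "w \<in> neighbours G c"
  shows "(u, w) \<notin> parcs G"
proof
  assume uw: "(u, w) \<in> parcs G"
  let ?p = "[(c, u), (u, w), (w, c)]"
  have arcs: "(c, u) \<in> parcs G" "(w, c) \<in> parcs G"
    using assms arc_sym by (auto simp: neighbours_def)
  then have "c \<noteq> u" "w \<noteq> c" "u \<noteq> w" using uw no_loop by blast+
  then have "cycle ?p"
    using arcs uw unfolding cycle_def
    by (intro exI[of _ c]) (auto simp: awalk_def dest: in_arcsD1)
  then show False using tree by (auto simp: undirected_tree_def)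
qed

lemma (in pair_graph) digraph_iso_claw:
  assumes tree: "undirected_tree G" and c: "c \<in> pverts G" and deg: "vertex_degree G c = 3"
    and all: "pverts G \<subseteq> insert c (neighbours G c)"
  shows "digraph_iso (with_proj G) (with_proj claw)"
proof -
  have "card (neighbours G c) = 3" using deg by (simp add: vertex_degree_eq_card_neighbours)
  then obtain x y z where N: "neighbours G c = {x, y, z}" and d: "x \<noteq> y" "x \<noteq> z" "y \<noteq> z"
    by (auto simp: card_3_iff)
  have dc: "c \<noteq> x" "c \<noteq> y" "c \<noteq> z" using not_self_neighbour[of c] N by auto
  have V: "pverts G = {c, x, y, z}" using all N c neighbours_subset[of c] by auto
  have star: "(u, v) \<in> parcs G \<longleftrightarrow> u = c \<and> v \<in> neighbours G c \<or> v = c \<and> u \<in> neighbours G c" for u v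
  proof
    assume uv: "(u, v) \<in> parcs G"
    show "u = c \<and> v \<in> neighbours G c \<or> v = c \<and> u \<in> neighbours G c"
    proof (cases "u = c \<or> v = c")
      case True
      then show ?thesis using uv arc_sym by (auto simp: neighbours_def)
    next
      case False
      then have "u \<in> neighbours G c" "v \<in> neighbours G c"
        using uv all in_arcsD1 in_arcsD2 by blast+
      then show ?thesis using no_arc_between_neighbours[OF tree] uv by blast
    qed
  qed (use arc_sym in \<open>auto simp: neighbours_def\<close>)
  have E: "parcs G = {c} \<times> {x, y, z} \<union> {x, y, z} \<times> {c}"
    using star N by auto
  define g :: "'a \<Rightarrow> nat" where "g v = (if v = c then 0 else if v = x then 1 else if v = y then 2 else 3)" for v
  have g: "g c = 0" "g x = 1" "g y = 2" "g z = 3" using d dc by (auto simp: g_def)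
  define iso where "iso = \<lparr>iso_verts = g, iso_arcs = map_prod g g, iso_head = snd, iso_tail = fst\<rparr>"
  have "digraph_isomorphism iso"
    using g d dc unfolding digraph_isomorphism_def iso_def
    by (auto simp: V E inj_on_def wf_digraph)
  moreover have "with_proj claw = app_iso iso (with_proj G)"
    using g by (auto simp: app_iso_def iso_def with_proj_def claw_def V E)
  ultimately show ?thesis by (auto simp: digraph_iso_def)
qed

text \<open>
  Arcs are pairs of vertices, so the arc component of an isomorphism is determined by its vertex
  component, and the vertex map alone carries all the information.
\<close>

lemma digraph_iso_imp_adjacency_bij:
  assumes "digraph_iso (with_proj G) (with_proj H)"
  obtains g where "inj_on g (pverts G)" "g ` pverts G = pverts H"
    "\<And>v. v \<in> pverts G \<Longrightarrow> g ` neighbours G v = neighbours H (g v)"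
proof -
  obtain h where h: "pre_digraph.digraph_isomorphism (with_proj G) h"
    and H: "with_proj H = app_iso h (with_proj G)"
    using assms by (auto simp: digraph_iso_def)
  define g where "g = iso_verts h"
  have wf: "wf_digraph (with_proj G)" and inj: "inj_on g (pverts G)"
    and arcs: "\<And>a. a \<in> parcs G \<Longrightarrow> iso_tail h (iso_arcs h a) = g (fst a) \<and> iso_head h (iso_arcs h a) = g (snd a)"
    using h by (auto simp: pre_digraph.digraph_isomorphism_def g_def)
  have "verts (with_proj H) = verts (app_iso h (with_proj G))"
    "arcs (with_proj H) = arcs (app_iso h (with_proj G))"
    "tail (with_proj H) = tail (app_iso h (with_proj G))"
    "head (with_proj H) = head (app_iso h (with_proj G))"
    using H by simp_all
  then have V: "pverts H = g ` pverts G" and A: "parcs H = iso_arcs h ` parcs G"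
    and "iso_tail h = fst" "iso_head h = snd"
    by (simp_all add: g_def)
  with arcs have "iso_arcs h a = map_prod g g a" if "a \<in> parcs G" for a
    using that by (metis prod_eq_iff fst_map_prod snd_map_prod)
  with A have A': "parcs H = map_prod g g ` parcs G" by simp
  have in_verts: "fst a \<in> pverts G" if "a \<in> parcs G" for a
    using wf_digraph.tail_in_verts[OF wf] that by simp
  show thesis
  proof (rule that[OF inj V[symmetric]])
    fix v assume v: "v \<in> pverts G"
    show "g ` neighbours G v = neighbours H (g v)"
      unfolding neighbours_def A' using inj_onD[OF inj _ v] in_verts by force
  qed
qed

text \<open>
  The vector \<open>(3, -1, -1, -1)\<close> is an eigenvector of the Laplacian of the claw, and the isomorphism
  carries it over to \<open>G\<close>.
\<close>

lemma (in numbered_graph) claw_eigenvalue_4: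
  assumes "digraph_iso (with_proj G) (with_proj claw)"
  shows "4 \<in># eigenvalue_mset L"
proof -
  obtain g where inj: "inj_on g (pverts G)" and img: "g ` pverts G = pverts claw"
    and nb: "\<And>v. v \<in> pverts G \<Longrightarrow> g ` neighbours G v = neighbours claw (g v)"
    using digraph_iso_imp_adjacency_bij[OF assms] by blast
  define h :: "nat \<Rightarrow> real" where "h j = (if j = 0 then 3 else - 1)" for j
  define f where "f v = h (g v)" for v
  have claw: "neighbours claw 0 = {1, 2, 3}" "\<And>j. j \<in> {1, 2, 3} \<Longrightarrow> neighbours claw j = {0}"
    by (auto simp: neighbours_def claw_def)
  have "(\<Sum>u\<in>neighbours G v. f v - f u) = 4 * f v" if v: "v \<in> pverts G" for v
  proof -
    have "(\<Sum>u\<in>neighbours G v. f v - f u) = (\<Sum>j\<in>neighbours claw (g v). h (g v) - h j)"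
      using inj_on_subset[OF inj neighbours_subset]
      by (simp add: nb[OF v, symmetric] sum.reindex f_def)
    moreover have "g v = 0 \<or> g v \<in> {1, 2, 3}" using imageI[OF v, of g] unfolding img by (simp add: claw_def)
    then have "(\<Sum>j\<in>neighbours claw (g v). h (g v) - h j) = 4 * h (g v)"
      by (elim disjE) (auto simp: claw h_def)
    ultimately show ?thesis by (simp add: f_def)
  qed
  then have "L *\<^sub>v vec_of f = 4 \<cdot>\<^sub>v vec_of f"
    unfolding laplacian_mult_vec_of using set_numbering nth_mem
    by (intro eq_vecI) (fastforce simp: vec_of_def)+
  moreover have "vec_of f \<noteq> 0\<^sub>v n"
  proof -
    have "pverts G \<noteq> {}" using img by (auto simp: claw_def)
    then have "n > 0" using set_numbering by auto
    moreover from this have "vec_of f $ 0 \<noteq> 0" by (simp add: vec_of_def f_def h_def)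
    ultimately show ?thesis by auto
  qed
  ultimately have "eigenvalue L 4"
    using laplacian_carrier unfolding eigenvalue_def eigenvector_def
    by (metis carrier_matD(1) vec_of_carrier)
  then show ?thesis by (simp add: in_eigenvalue_mset_iff[OF laplacian_carrier])
qed

section \<open>Starlike trees\<close>

theorem corollary3p1:
  fixes T :: "'a pair_pre_digraph" and vs :: "'a list"
  assumes "starlike_tree T"
    and "distinct vs" and "set vs = pverts T"
  shows "\<exists>\<mu>. filter_mset (\<lambda>x. x \<ge> 4) (eigenvalue_mset (laplacian T vs)) = {#\<mu>#} \<and>
    (\<mu> = 4 \<longleftrightarrow> digraph_iso (with_proj T) (with_proj claw))"
proof -
  have tree: "undirected_tree T" and ex1: "\<exists>!v. v \<in> pverts T \<and> vertex_degree T v > 2"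
    using assms(1) by (simp_all add: starlike_tree_def)
  then have "pair_graph T" and conn: "Digraph_Component.connected (with_proj T)"
    by (simp_all add: undirected_tree_def)
  then interpret numbered_graph T vs
    using assms(2,3) by (simp add: numbered_graph_def numbered_graph_axioms_def)
  obtain c where c: "c \<in> pverts T" "vertex_degree T c > 2"
    and unique: "\<And>v. v \<in> pverts T \<and> vertex_degree T v > 2 \<Longrightarrow> v = c"
    using ex1 by blast
  have deg: "vertex_degree T v \<le> 2" if "v \<in> pverts T" "v \<noteq> c" for v
    using unique[of v] that by linarith
  obtain i where i: "i < n" "vs ! i = c"
    using c(1) assms(3) by (metis in_set_conv_nth)
  have le1: "size (filter_mset (\<lambda>x. x \<ge> 4) (eigenvalue_mset L)) \<le> 1"
  proof (rule at_most_one_eigenvalue_ge[OF laplacian_carrier laplacian_symmetric i(1)])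
    fix x :: "real vec"
    assume x: "x \<in> carrier_vec n" "x \<noteq> 0\<^sub>v n" "x $ i = 0"
    obtain f where f: "x = vec_of f" using vec_of_surj[OF x(1)] .
    then have "f c = 0" using x(3) i by (simp add: vec_of_def)
    then show "x \<bullet> (L *\<^sub>v x) < 4 * (x \<bullet> x)"
      using laplacian_form_less_if_zero_at_centre[OF conn c(1) _ deg] x(2) by (simp add: f)
  qed
  define k where "k = vertex_degree T c"
  have k: "k \<ge> 3" "k > 0" using c(2) by (simp_all add: k_def)
  obtain f where pos: "vec_of f \<bullet> vec_of f > 0"
    and ge: "laplacian_form f \<ge> (real k + 1) * (vec_of f \<bullet> vec_of f)"
    and eq: "laplacian_form f \<le> (real k + 1) * (vec_of f \<bullet> vec_of f) \<longrightarrow>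
       (\<forall>u \<in> neighbours T c. neighbours T u \<subseteq> insert c (neighbours T c))"
    using star_test_vector[OF c(1) k_def[symmetric] k(2)] by blast
  have "n > 0" using i by linarith
  then obtain \<mu> where \<mu>: "\<mu> \<in># eigenvalue_mset L" "laplacian_form f \<le> \<mu> * (vec_of f \<bullet> vec_of f)"
    using eigenvalue_ge_Rayleigh_quotient[OF laplacian_carrier laplacian_symmetric vec_of_carrier]
    by blast
  have "(real k + 1) * (vec_of f \<bullet> vec_of f) \<le> \<mu> * (vec_of f \<bullet> vec_of f)"
    using ge \<mu>(2) by linarith
  then have \<mu>_ge: "real k + 1 \<le> \<mu>" using pos by simp
  then have "\<mu> \<in># filter_mset (\<lambda>x. x \<ge> 4) (eigenvalue_mset L)" using \<mu>(1) k by simp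
  then obtain M where M: "filter_mset (\<lambda>x. x \<ge> 4) (eigenvalue_mset L) = add_mset \<mu> M"
    by (rule mset_add)
  with le1 have single: "filter_mset (\<lambda>x. x \<ge> 4) (eigenvalue_mset L) = {#\<mu>#}" by simp
  moreover have "\<mu> = 4 \<longleftrightarrow> digraph_iso (with_proj T) (with_proj claw)"
  proof
    assume "\<mu> = 4"
    then have k3: "k = 3" using \<mu>_ge k by simp
    then have "laplacian_form f \<le> (real k + 1) * (vec_of f \<bullet> vec_of f)"
      using \<mu>(2) \<open>\<mu> = 4\<close> by simp
    with eq have closed: "neighbours T u \<subseteq> insert c (neighbours T c)" if "u \<in> neighbours T c" for u
      using that by blast
    have "pverts T \<subseteq> insert c (neighbours T c)"
    proof (rule connected_closed_set[OF conn c(1)])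
      fix u v assume "(u, v) \<in> parcs T" "u \<in> insert c (neighbours T c)"
      then show "v \<in> insert c (neighbours T c)"
        using closed[of u] by (auto simp: neighbours_def)
    qed simp
    then show "digraph_iso (with_proj T) (with_proj claw)"
      using digraph_iso_claw[OF tree c(1)] k3 by (simp add: k_def)
  next
    assume "digraph_iso (with_proj T) (with_proj claw)"
    then have "4 \<in># filter_mset (\<lambda>x. x \<ge> 4) (eigenvalue_mset L)"
      using claw_eigenvalue_4 by simp
    then show "\<mu> = 4" by (simp add: single)
  qed
  ultimately show ?thesis by blast
qed

end
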